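(* Let $R$ be a ring without unity that has a finite cover. Then there exists a ring $R'$ with unity such that $\sigma(R) = \sigma_u(R')$. Thus, every (finite) covering number of a nonunital ring by subrings occurs as the covering number of a unital ring by unital subrings.
   Context: Rings are associative, not necessarily commutative or unital. A subring is an additive subgroup closed under multiplication. A cover of $R$ is a collection of proper subrings whose union is $R$; if one exists, $\sigma(R)$ is the least cardinality of a cover, and otherwise $\sigma(R)=\infty$. For a ring $R$ with unity $1_R$, a unital subring is a subring containing $1_R$; if $R$ is a union of proper unital subrings, the unital covering number $\sigma_u(R)$ is the least cardinality of a cover of $R$ by proper unital subrings (and $\sigma_u(R)=\infty$ if there is no such cover). *)

theory Defs
  imports "HOL-Algebra.Subrings" "HOL-Algebra.AbelCoset" "HOL-Library.Extended_Nat"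
begin

text \<open>
  The locale \<open>ring\<close> of HOL-Algebra is unital.  A \<open>rng\<close> is an associative ring that need not have a
  unity; it uses the same records, but its axioms (and all notions for rngs below) ignore the
  field \<open>one\<close>.
\<close>

locale rng = abelian_group R for R (structure) +
  assumes m_closed: "\<lbrakk> x \<in> carrier R; y \<in> carrier R \<rbrakk> \<Longrightarrow> x \<otimes> y \<in> carrier R"
    and m_assoc: "\<lbrakk> x \<in> carrier R; y \<in> carrier R; z \<in> carrier R \<rbrakk>
      \<Longrightarrow> (x \<otimes> y) \<otimes> z = x \<otimes> (y \<otimes> z)"
    and l_distr: "\<lbrakk> x \<in> carrier R; y \<in> carrier R; z \<in> carrier R \<rbrakk>
      \<Longrightarrow> (x \<oplus> y) \<otimes> z = x \<otimes> z \<oplus> y \<otimes> z"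
    and r_distr: "\<lbrakk> x \<in> carrier R; y \<in> carrier R; z \<in> carrier R \<rbrakk>
      \<Longrightarrow> z \<otimes> (x \<oplus> y) = z \<otimes> x \<oplus> z \<otimes> y"

definition has_unity :: "('a, 'm) ring_scheme \<Rightarrow> bool" where
  "has_unity R \<longleftrightarrow>
    (\<exists>e\<in>carrier R. \<forall>x\<in>carrier R. e \<otimes>\<^bsub>R\<^esub> x = x \<and> x \<otimes>\<^bsub>R\<^esub> e = x)"

text \<open>
  A subrng need not contain a unity.  Unital subrings are the library's \<open>subring\<close>, which requires
  the element \<open>one\<close> of the ambient ring.
\<close>

definition subrng :: "'a set \<Rightarrow> ('a, 'm) ring_scheme \<Rightarrow> bool" where
  "subrng S R \<longleftrightarrow> additive_subgroup S R \<and> (\<forall>x\<in>S. \<forall>y\<in>S. x \<otimes>\<^bsub>R\<^esub> y \<in> S)"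

definition cover :: "('a, 'm) ring_scheme \<Rightarrow> 'a set set \<Rightarrow> bool" where
  "cover R C \<longleftrightarrow> (\<forall>S\<in>C. subrng S R \<and> S \<noteq> carrier R) \<and> \<Union>C = carrier R"

definition unital_cover :: "('a, 'm) ring_scheme \<Rightarrow> 'a set set \<Rightarrow> bool" where
  "unital_cover R C \<longleftrightarrow> (\<forall>S\<in>C. subring S R \<and> S \<noteq> carrier R) \<and> \<Union>C = carrier R"

text \<open>
  Covering numbers are taken in \<open>enat\<close>, where the infimum of the empty set is \<open>\<infinity>\<close> and the infimum
  of a nonempty set is attained.  Thus a ring all of whose covers are infinite gets the value \<open>\<infinity>\<close>,
  like a ring without any cover; finite covering numbers are exact.
\<close>

definition covering_number :: "('a, 'm) ring_scheme \<Rightarrow> enat" (\<open>\<sigma>\<close>) where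
  "\<sigma> R = Inf {enat (card C) | C. finite C \<and> cover R C}"

definition unital_covering_number :: "('a, 'm) ring_scheme \<Rightarrow> enat" (\<open>\<sigma>\<^sub>u\<close>) where
  "\<sigma>\<^sub>u R = Inf {enat (card C) | C. finite C \<and> unital_cover R C}"

end

theory Submission
  imports Defs
begin

text \<open>
  Every rng \<open>R\<close> is a two-sided ideal of its Dorroh extension \<open>D = \<int> \<times> R\<close>, in which \<open>(m, x)\<close> stands
  for the formal sum \<open>m \<sqdot> 1 + x\<close>.  A unital subring \<open>T\<close> of \<open>D\<close> contains \<open>(1, 0)\<close> and therefore all
  of \<open>\<int> \<times> {0}\<close>, so whether \<open>(m, x)\<close> belongs to \<open>T\<close> does not depend on \<open>m\<close>.  Hence \<open>T = \<int> \<times> S\<close> for a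
  subrng \<open>S\<close> of \<open>R\<close>, and conversely every \<open>\<int> \<times> S\<close> is a unital subring
  (\<open>subring_dorroh_iff\<close>).  The bijection \<open>S \<mapsto> \<int> \<times> S\<close> commutes with unions and sends the improper
  subrng \<open>R\<close> to \<open>D\<close>, so it matches the covers of \<open>R\<close> by proper subrngs with the covers of \<open>D\<close>
  by proper unital subrings, preserving cardinalities.  The two covering numbers therefore agree
  (\<open>unital_covering_number_dorroh\<close>).
\<close>

definition dorroh :: "('a, 'm) ring_scheme \<Rightarrow> (int \<times> 'a) ring" where
  "dorroh R = \<lparr> carrier = UNIV \<times> carrier R,
     mult = (\<lambda>(m, x) (n, y). (m * n, [m] \<cdot>\<^bsub>R\<^esub> y \<oplus>\<^bsub>R\<^esub> [n] \<cdot>\<^bsub>R\<^esub> x \<oplus>\<^bsub>R\<^esub> x \<otimes>\<^bsub>R\<^esub> y)),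
     one = (1, \<zero>\<^bsub>R\<^esub>), zero = (0, \<zero>\<^bsub>R\<^esub>),
     add = (\<lambda>(m, x) (n, y). (m + n, x \<oplus>\<^bsub>R\<^esub> y)) \<rparr>"

lemma dorroh_simps [simp]:
  "carrier (dorroh R) = UNIV \<times> carrier R"
  "(m, x) \<otimes>\<^bsub>dorroh R\<^esub> (n, y) = (m * n, [m] \<cdot>\<^bsub>R\<^esub> y \<oplus>\<^bsub>R\<^esub> [n] \<cdot>\<^bsub>R\<^esub> x \<oplus>\<^bsub>R\<^esub> x \<otimes>\<^bsub>R\<^esub> y)"
  "\<one>\<^bsub>dorroh R\<^esub> = (1, \<zero>\<^bsub>R\<^esub>)"
  "\<zero>\<^bsub>dorroh R\<^esub> = (0, \<zero>\<^bsub>R\<^esub>)"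
  "(m, x) \<oplus>\<^bsub>dorroh R\<^esub> (n, y) = (m + n, x \<oplus>\<^bsub>R\<^esub> y)"
  by (simp_all add: dorroh_def)

context rng
begin

text \<open>
  Multiplication by a fixed element on either side is an endomorphism of the additive group, hence
  commutes with taking integer multiples and annihilates zero.
\<close>

lemma mult_right_hom:
  assumes "y \<in> carrier R"
  shows "group_hom (add_monoid R) (add_monoid R) (\<lambda>x. x \<otimes> y)"
  using assms by (intro group_hom.intro group_hom_axioms.intro a_group homI)
    (auto simp: m_closed l_distr)

lemma mult_left_hom:
  assumes "x \<in> carrier R"
  shows "group_hom (add_monoid R) (add_monoid R) (\<lambda>y. x \<otimes> y)"
  using assms by (intro group_hom.intro group_hom_axioms.intro a_group homI)
    (auto simp: m_closed r_distr)

lemma zmult_mult_left: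
  assumes "x \<in> carrier R" "y \<in> carrier R"
  shows "([(k :: int)] \<cdot> x) \<otimes> y = [k] \<cdot> (x \<otimes> y)"
  using group_hom.hom_int_pow[OF mult_right_hom, of y x k] assms by (simp add: add_pow_def)

lemma zmult_mult_right:
  assumes "x \<in> carrier R" "y \<in> carrier R"
  shows "x \<otimes> ([(k :: int)] \<cdot> y) = [k] \<cdot> (x \<otimes> y)"
  using group_hom.hom_int_pow[OF mult_left_hom, of x y k] assms by (simp add: add_pow_def)

lemma zero_mult: "y \<in> carrier R \<Longrightarrow> \<zero> \<otimes> y = \<zero>"
  using group_hom.hom_one[OF mult_right_hom, of y] by simp

lemma mult_zero: "x \<in> carrier R \<Longrightarrow> x \<otimes> \<zero> = \<zero>"
  using group_hom.hom_one[OF mult_left_hom, of x] by simp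

lemma ring_dorroh: "ring (dorroh R)"
proof (rule ringI)
  show "abelian_group (dorroh R)"
  proof (rule abelian_groupI)
    fix p assume "p \<in> carrier (dorroh R)"
    then obtain m x where p: "p = (m, x)" "x \<in> carrier R" by auto
    have "(- m, \<ominus> x) \<oplus>\<^bsub>dorroh R\<^esub> p = \<zero>\<^bsub>dorroh R\<^esub>" using p by (simp add: l_neg)
    then show "\<exists>q\<in>carrier (dorroh R). q \<oplus>\<^bsub>dorroh R\<^esub> p = \<zero>\<^bsub>dorroh R\<^esub>"
      using p by (intro bexI[of _ "(- m, \<ominus> x)"]) auto
  qed (auto simp: a_ac)
  show "monoid (dorroh R)"
  proof (rule monoidI)
    fix p q r
    assume "p \<in> carrier (dorroh R)" "q \<in> carrier (dorroh R)" "r \<in> carrier (dorroh R)"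
    then obtain l x m y n z where eqs: "p = (l, x)" "q = (m, y)" "r = (n, z)"
      and carr: "x \<in> carrier R" "y \<in> carrier R" "z \<in> carrier R" by auto
    have zmult_zmult: "[k] \<cdot> ([j] \<cdot> w) = [(k * j)] \<cdot> w" if "w \<in> carrier R" for k j :: int and w
      using add.int_pow_pow[OF that, of k j] by (simp add: mult.commute)
    show "p \<otimes>\<^bsub>dorroh R\<^esub> q \<otimes>\<^bsub>dorroh R\<^esub> r = p \<otimes>\<^bsub>dorroh R\<^esub> (q \<otimes>\<^bsub>dorroh R\<^esub> r)"
      using carr unfolding eqs
      by (simp add: m_closed l_distr r_distr m_assoc zmult_mult_left zmult_mult_right
        add.int_pow_distrib zmult_zmult a_ac mult.commute mult.left_commute)
  qed (auto simp: m_closed zero_mult mult_zero)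
  fix p q r
  assume "p \<in> carrier (dorroh R)" "q \<in> carrier (dorroh R)" "r \<in> carrier (dorroh R)"
  then obtain l x m y n z where eqs: "p = (l, x)" "q = (m, y)" "r = (n, z)"
    and carr: "x \<in> carrier R" "y \<in> carrier R" "z \<in> carrier R" by auto
  note zmult = add.int_pow_distrib add.int_pow_mult
  show "(p \<oplus>\<^bsub>dorroh R\<^esub> q) \<otimes>\<^bsub>dorroh R\<^esub> r = p \<otimes>\<^bsub>dorroh R\<^esub> r \<oplus>\<^bsub>dorroh R\<^esub> q \<otimes>\<^bsub>dorroh R\<^esub> r"
    using carr unfolding eqs by (simp add: m_closed l_distr zmult a_ac distrib_right)
  show "r \<otimes>\<^bsub>dorroh R\<^esub> (p \<oplus>\<^bsub>dorroh R\<^esub> q) = r \<otimes>\<^bsub>dorroh R\<^esub> p \<oplus>\<^bsub>dorroh R\<^esub> r \<otimes>\<^bsub>dorroh R\<^esub> q"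
    using carr unfolding eqs by (simp add: m_closed r_distr zmult a_ac distrib_left)
qed

lemma subrngI:
  assumes "S \<subseteq> carrier R" "\<zero> \<in> S" "\<And>x. x \<in> S \<Longrightarrow> \<ominus> x \<in> S"
    and "\<And>x y. x \<in> S \<Longrightarrow> y \<in> S \<Longrightarrow> x \<oplus> y \<in> S" "\<And>x y. x \<in> S \<Longrightarrow> y \<in> S \<Longrightarrow> x \<otimes> y \<in> S"
  shows "subrng S R"
  unfolding subrng_def using assms
  by (auto intro!: additive_subgroupI add.subgroupI)

lemma dorroh_minus:
  assumes "x \<in> carrier R"
  shows "\<ominus>\<^bsub>dorroh R\<^esub> (m, x) = (- m, \<ominus> x)"
  using assms by (intro abelian_group.minus_equality ring.axioms(1) ring_dorroh) (auto simp: l_neg)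

lemma subring_dorroh_if_subrng:
  assumes "subrng S R"
  shows "subring (UNIV \<times> S) (dorroh R)"
proof -
  from assms interpret S: additive_subgroup S R by (simp add: subrng_def)
  have zmult: "[(k :: int)] \<cdot> x \<in> S" if "x \<in> S" for k x
    using add.subgroup_int_pow_closed[OF S.a_subgroup that, of k] by simp
  have mult: "x \<otimes> y \<in> S" if "x \<in> S" "y \<in> S" for x y
    using assms that by (simp add: subrng_def)
  have carr: "x \<in> carrier R" if "x \<in> S" for x
    using S.a_subset that by blast
  show ?thesis
    by (rule ring.subringI[OF ring_dorroh]) (auto simp: dorroh_minus zmult mult carr)
qed

text \<open>
  Translating by the elements \<open>(k, 0)\<close>, all of which lie in \<open>T\<close> together with the unity, moves
  between \<open>(m, x)\<close> and \<open>(0, x)\<close> inside \<open>T\<close>; so \<open>T\<close> is a product.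
\<close>

lemma subring_dorroh_iff: "subring T (dorroh R) \<longleftrightarrow> (\<exists>S. subrng S R \<and> T = UNIV \<times> S)"
proof
  assume T: "subring T (dorroh R)"
  note TE = subringE[OF T]
  have sub: "x \<in> carrier R" if "(m, x) \<in> T" for m x using TE(1) that by auto
  have add: "(m + n, x \<oplus> y) \<in> T" if "(m, x) \<in> T" "(n, y) \<in> T" for m n x y
    using TE(7)[OF that] by simp
  have minus: "(- m, \<ominus> x) \<in> T" if "(m, x) \<in> T" for m x
    using TE(5)[OF that] sub[OF that] by (simp add: dorroh_minus)
  have ints: "(k, \<zero>) \<in> T" for k
  proof (induction k rule: int_induct[of _ 0])
    case base
    then show ?case using TE(2) by simp
  next
    case (step1 k)
    then show ?case using add[of k \<zero> 1 \<zero>] TE(3) by simp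
  next
    case (step2 k)
    have "\<ominus> \<zero> = \<zero>" by (simp add: minus_equality)
    then have "(- 1, \<zero>) \<in> T" using minus[of 1 \<zero>] TE(3) by (metis dorroh_simps(3))
    then show ?case using add[OF step2(2), of "- 1" \<zero>] by simp
  qed
  have shift: "(n, x) \<in> T" if "(m, x) \<in> T" for m n x
    using add[OF ints[of "n - m"] that] sub[OF that] by simp
  let ?S = "{x. (0, x) \<in> T}"
  have "T = UNIV \<times> ?S" using shift by auto
  moreover have "subrng ?S R"
  proof (rule subrngI)
    fix x y assume xy: "x \<in> ?S" "y \<in> ?S"
    then have "x \<in> carrier R" "y \<in> carrier R" using sub by auto
    then show "x \<otimes> y \<in> ?S" using xy TE(6)[of "(0, x)" "(0, y)"] by (simp add: m_closed add_pow_def)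
  qed (use sub ints add[of 0 _ 0] minus[of 0] in auto)
  ultimately show "\<exists>S. subrng S R \<and> T = UNIV \<times> S" by blast
qed (auto intro: subring_dorroh_if_subrng)

lemma unital_cover_dorroh_iff:
  "unital_cover (dorroh R) D \<longleftrightarrow> (\<exists>C. cover R C \<and> D = (\<times>) UNIV ` C)"
proof
  have inj: "UNIV \<times> A = (UNIV :: int set) \<times> B \<longleftrightarrow> A = B" for A B :: "'a set"
    by auto
  have Union: "\<Union> ((\<times>) UNIV ` C) = (UNIV :: int set) \<times> \<Union> C" for C :: "'a set set"
    by auto
  show "\<exists>C. cover R C \<and> D = (\<times>) UNIV ` C" if D: "unital_cover (dorroh R) D"
  proof -
    let ?C = "{S. UNIV \<times> S \<in> D}"
    have D_eq: "D = (\<times>) UNIV ` ?C"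
      using D by (auto simp: unital_cover_def subring_dorroh_iff image_iff)
    have "subrng S R \<and> S \<noteq> carrier R" if "UNIV \<times> S \<in> D" for S
    proof -
      from D that have "subring (UNIV \<times> S) (dorroh R)" "UNIV \<times> S \<noteq> carrier (dorroh R)"
        by (auto simp: unital_cover_def)
      then show ?thesis by (auto simp: subring_dorroh_iff inj)
    qed
    moreover have "\<Union> ?C = carrier R"
    proof -
      have "UNIV \<times> \<Union> ?C = \<Union> D" using Union[of ?C] D_eq by simp
      also have "\<dots> = UNIV \<times> carrier R" using D by (simp add: unital_cover_def)
      finally show ?thesis by (simp only: inj)
    qed
    ultimately have "cover R ?C" by (auto simp: cover_def)
    with D_eq show ?thesis by blast
  qed
  show "unital_cover (dorroh R) D" if "\<exists>C. cover R C \<and> D = (\<times>) UNIV ` C"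
  proof -
    from that obtain C where C: "cover R C" and D: "D = (\<times>) UNIV ` C" by blast
    have "\<Union> D = carrier (dorroh R)" using C Union[of C] by (simp add: D cover_def)
    moreover have "subring T (dorroh R) \<and> T \<noteq> carrier (dorroh R)" if "T \<in> D" for T
      using C that by (auto simp: D cover_def inj subring_dorroh_if_subrng)
    ultimately show ?thesis by (auto simp: unital_cover_def)
  qed
qed

theorem unital_covering_number_dorroh: "\<sigma>\<^sub>u (dorroh R) = \<sigma> R"
proof -
  have inj: "inj_on ((\<times>) (UNIV :: int set)) C" for C :: "'a set set"
    by (auto simp: inj_on_def)
  have "{enat (card D) | D. finite D \<and> unital_cover (dorroh R) D} =
      {enat (card ((\<times>) (UNIV :: int set) ` C)) | C. finite ((\<times>) (UNIV :: int set) ` C) \<and> cover R C}"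
    unfolding unital_cover_dorroh_iff by blast
  also have "\<dots> = {enat (card C) | C. finite C \<and> cover R C}"
    by (simp only: card_image[OF inj] finite_image_iff[OF inj])
  finally show ?thesis by (simp add: covering_number_def unital_covering_number_def)
qed

end

theorem theorem1p5:
  shows "(\<forall>R :: 'a ring. rng R \<and> \<not> has_unity R \<and> (\<exists>C. finite C \<and> cover R C) \<longrightarrow>
            (\<exists>R' :: (int \<times> 'a) ring. ring R' \<and> \<sigma> R = \<sigma>\<^sub>u R')) \<and>
         (\<forall>n :: nat. (\<exists>R :: 'a ring. rng R \<and> \<not> has_unity R \<and> \<sigma> R = enat n) \<longrightarrow>
            (\<exists>R' :: (int \<times> 'a) ring. ring R' \<and> \<sigma>\<^sub>u R' = enat n))"
proof (intro conjI allI impI)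
  fix R :: "'a ring"
  assume "rng R \<and> \<not> has_unity R \<and> (\<exists>C. finite C \<and> cover R C)"
  then interpret rng R by simp
  show "\<exists>R' :: (int \<times> 'a) ring. ring R' \<and> \<sigma> R = \<sigma>\<^sub>u R'"
    using ring_dorroh unital_covering_number_dorroh by (intro exI[of _ "dorroh R"]) simp
next
  fix n :: nat
  assume "\<exists>R :: 'a ring. rng R \<and> \<not> has_unity R \<and> \<sigma> R = enat n"
  then obtain R :: "'a ring" where "rng R" and n: "\<sigma> R = enat n" by blast
  then interpret rng R by simp
  show "\<exists>R' :: (int \<times> 'a) ring. ring R' \<and> \<sigma>\<^sub>u R' = enat n"
    using ring_dorroh unital_covering_number_dorroh n by (intro exI[of _ "dorroh R"]) simp
qed

end
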